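(* Let $N_A$ be a submultiplicative seminorm on $\mathbb{B}_{A^{1/2}}(\mathcal{H})$ and let $T\in\mathbb{B}_A(\mathcal{H})$. Then $$\omega_{N_A}(T)\ \ge\ \sqrt{\frac14 N_A\big(T^{\sharp_A}T+TT^{\sharp_A}\big)+\frac12\Big|N_A^2(\Re_A(T))-N_A^2(\Im_A(T))\Big|}.$$
   Context: $\mathcal{H}$ is a complex Hilbert space with inner product $\langle\cdot,\cdot\rangle$, $\mathbb{B}(\mathcal{H})$ is the algebra of bounded linear operators on $\mathcal{H}$, and $A\in\mathbb{B}(\mathcal{H})$ is a non-zero positive operator ($\langle Ax,x\rangle\ge 0$ for all $x$). Put $\|x\|_A=\sqrt{\langle Ax,x\rangle}$. $\mathbb{B}_A(\mathcal{H})$ is the set of $T\in\mathbb{B}(\mathcal{H})$ with $\mathcal{R}(T^*A)\subseteq\mathcal{R}(A)$ ($\mathcal{R}$ denotes range). $\mathbb{B}_{A^{1/2}}(\mathcal{H})$ is the set of $T\in\mathbb{B}(\mathcal{H})$ for which there is $c>0$ with $\|Tx\|_A\le c\|x\|_A$ for all $x\in\mathcal{H}$. Both are subalgebras of $\mathbb{B}(\mathcal{H})$ and $\mathbb{B}_A(\mathcal{H})\subseteq\mathbb{B}_{A^{1/2}}(\mathcal{H})$. For $T\in\mathbb{B}_A(\mathcal{H})$, $T^{\sharp_A}$ is the unique $X\in\mathbb{B}(\mathcal{H})$ with $AX=T^*A$ and $\mathcal{R}(X)\subseteq\overline{\mathcal{R}(A)}$; one has $T^{\sharp_A}\in\mathbb{B}_A(\mathcal{H})$.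 Put $\Re_A(T)=\frac{T+T^{\sharp_A}}{2}$ and $\Im_A(T)=\frac{T-T^{\sharp_A}}{2i}$. For a seminorm $N_A$, $\omega_{N_A}(T)=\sup_{\theta\in\mathbb{R}}N_A\big(\Re_A(e^{i\theta}T)\big)$ for $T\in\mathbb{B}_A(\mathcal{H})$, and $N_A^2(T)$ means $(N_A(T))^2$. $N_A$ is submultiplicative if $N_A(TS)\le N_A(T)N_A(S)$ for all $T,S\in\mathbb{B}_{A^{1/2}}(\mathcal{H})$. *)

theory Defs
  imports "HOL-Analysis.Analysis"
begin

class complex_vector = real_vector +
  fixes scaleC :: "complex \<Rightarrow> 'a \<Rightarrow> 'a"  (infixr "*\<^sub>C" 75)
  assumes scaleC_add_right: "c *\<^sub>C (x + y) = c *\<^sub>C x + c *\<^sub>C y"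
    and scaleC_add_left: "(c + d) *\<^sub>C x = c *\<^sub>C x + d *\<^sub>C x"
    and scaleC_scaleC: "c *\<^sub>C d *\<^sub>C x = (c * d) *\<^sub>C x"
    and scaleC_one: "1 *\<^sub>C x = x"
    and scaleR_scaleC: "r *\<^sub>R x = complex_of_real r *\<^sub>C x"

text \<open>The complex inner product is linear in the first argument. Its positive definiteness, and the
  fact that it induces the norm, come from \<^class>\<open>real_inner\<close> through \<open>inner_Re_cinner\<close>.\<close>

class complex_inner = complex_vector + real_inner +
  fixes cinner :: "'a \<Rightarrow> 'a \<Rightarrow> complex"
  assumes cinner_commute: "cinner x y = cnj (cinner y x)"
    and cinner_add_left: "cinner (x + y) z = cinner x z + cinner y z"
    and cinner_scaleC_left: "cinner (c *\<^sub>C x) y = c * cinner x y"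
    and inner_Re_cinner: "inner x y = Re (cinner x y)"

class complex_hilbert = complex_inner + complete_space

instantiation complex :: complex_hilbert
begin

definition scaleC_complex :: "complex \<Rightarrow> complex \<Rightarrow> complex"
  where "scaleC_complex c x = c * x"

definition cinner_complex :: "complex \<Rightarrow> complex \<Rightarrow> complex"
  where "cinner_complex x y = x * cnj y"

instance
  by standard
    (auto simp: scaleC_complex_def cinner_complex_def algebra_simps scaleR_conv_of_real inner_complex_def)

end

definition bounded_clinear :: "('h::complex_hilbert \<Rightarrow> 'h) \<Rightarrow> bool"
  where "bounded_clinear T \<longleftrightarrow> bounded_linear T \<and> (\<forall>c x. T (c *\<^sub>C x) = c *\<^sub>C T x)"

definition cadjoint :: "('h::complex_hilbert \<Rightarrow> 'h) \<Rightarrow> 'h \<Rightarrow> 'h"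
  where "cadjoint T = (THE S. bounded_clinear S \<and> (\<forall>x y. cinner (T x) y = cinner x (S y)))"

text \<open>Membership in \<open>\<real>\<^sub>\<ge>\<^sub>0\<close> (as a set of complex numbers) says that the value is real and
  non-negative.\<close>

definition positive_op :: "('h::complex_hilbert \<Rightarrow> 'h) \<Rightarrow> bool"
  where "positive_op A \<longleftrightarrow> bounded_clinear A \<and> (\<forall>x. cinner (A x) x \<in> \<real>\<^sub>\<ge>\<^sub>0)"

definition norm_A :: "('h::complex_hilbert \<Rightarrow> 'h) \<Rightarrow> 'h \<Rightarrow> real"
  where "norm_A A x = sqrt (Re (cinner (A x) x))"

definition B_A :: "('h::complex_hilbert \<Rightarrow> 'h) \<Rightarrow> ('h \<Rightarrow> 'h) set"
  where "B_A A = {T. bounded_clinear T \<and> range (cadjoint T \<circ> A) \<subseteq> range A}"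

definition B_sqrt_A :: "('h::complex_hilbert \<Rightarrow> 'h) \<Rightarrow> ('h \<Rightarrow> 'h) set"
  where "B_sqrt_A A =
    {T. bounded_clinear T \<and> (\<exists>c>0. \<forall>x. norm_A A (T x) \<le> c * norm_A A x)}"

definition sharp_A :: "('h::complex_hilbert \<Rightarrow> 'h) \<Rightarrow> ('h \<Rightarrow> 'h) \<Rightarrow> 'h \<Rightarrow> 'h"
  where "sharp_A A T =
    (THE X. bounded_clinear X \<and> A \<circ> X = cadjoint T \<circ> A \<and> range X \<subseteq> closure (range A))"

definition Re_A :: "('h::complex_hilbert \<Rightarrow> 'h) \<Rightarrow> ('h \<Rightarrow> 'h) \<Rightarrow> 'h \<Rightarrow> 'h"
  where "Re_A A T = (\<lambda>x. (1 / 2) *\<^sub>C (T x + sharp_A A T x))"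

definition Im_A :: "('h::complex_hilbert \<Rightarrow> 'h) \<Rightarrow> ('h \<Rightarrow> 'h) \<Rightarrow> 'h \<Rightarrow> 'h"
  where "Im_A A T = (\<lambda>x. (1 / (2 * \<i>)) *\<^sub>C (T x - sharp_A A T x))"

text \<open>A seminorm on \<^term>\<open>B_sqrt_A A\<close> is a function on all maps; nothing is assumed about its values
  outside \<^term>\<open>B_sqrt_A A\<close>.\<close>

definition seminorm_B :: "('h::complex_hilbert \<Rightarrow> 'h) \<Rightarrow> (('h \<Rightarrow> 'h) \<Rightarrow> real) \<Rightarrow> bool"
  where "seminorm_B A N \<longleftrightarrow>
    (\<forall>T\<in>B_sqrt_A A. 0 \<le> N T) \<and>
    (\<forall>T\<in>B_sqrt_A A. \<forall>c. N (\<lambda>x. c *\<^sub>C T x) = cmod c * N T) \<and>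
    (\<forall>T\<in>B_sqrt_A A. \<forall>S\<in>B_sqrt_A A. N (\<lambda>x. T x + S x) \<le> N T + N S)"

definition submultiplicative_B :: "('h::complex_hilbert \<Rightarrow> 'h) \<Rightarrow> (('h \<Rightarrow> 'h) \<Rightarrow> real) \<Rightarrow> bool"
  where "submultiplicative_B A N \<longleftrightarrow>
    (\<forall>T\<in>B_sqrt_A A. \<forall>S\<in>B_sqrt_A A. N (T \<circ> S) \<le> N T * N S)"

text \<open>For a seminorm \<open>N\<close> and \<open>T\<close> in \<^term>\<open>B_A A\<close> the supremum is over a bounded set, since
  \<open>N (Re_A A (e\<^sup>i\<^sup>\<theta> T)) \<le> (N T + N (sharp_A A T)) / 2\<close>.\<close>

definition omega :: "(('h::complex_hilbert \<Rightarrow> 'h) \<Rightarrow> real) \<Rightarrow> ('h \<Rightarrow> 'h) \<Rightarrow> ('h \<Rightarrow> 'h) \<Rightarrow> real"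
  where "omega N A T = (SUP \<theta>::real. N (Re_A A (\<lambda>x. cis \<theta> *\<^sub>C T x)))"

end

theory Submission
  imports Defs
begin

text \<open>Write \<open>T\<^sup>\<sharp>\<close> for \<open>sharp_A A T\<close>, \<open>R\<close> for \<open>Re_A A T\<close> and \<open>I\<close> for \<open>Im_A A T\<close>. Since \<open>T = R + \<i> I\<close> and
  \<open>T\<^sup>\<sharp> = R - \<i> I\<close>, the operator \<open>T\<^sup>\<sharp> T + T T\<^sup>\<sharp>\<close> equals \<open>2 (R\<^sup>2 + I\<^sup>2)\<close>
  (\<open>sharp_A_square_sum\<close>). Subadditivity and submultiplicativity therefore bound the expression under
  the root by \<open>(N R\<^sup>2 + N I\<^sup>2) / 2 + \<bar>N R\<^sup>2 - N I\<^sup>2\<bar> / 2\<close>, where \<open>N R\<^sup>2\<close> is the square of \<open>N R\<close>; that is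
  the larger of the two squares. Both \<open>N R\<close> and \<open>N I\<close> are at most \<open>omega N A T\<close>: they are the values
  at the angles \<open>0\<close> and \<open>- (pi / 2)\<close> of the function whose supremum is \<open>omega N A T\<close>
  (\<open>Re_A_rotate_eq_Im_A\<close>, \<open>seminorm_rotated_Re_A_le_omega\<close>).
  
  The weight of the proof lies in making this computation legitimate. The laws of the seminorm hold
  on \<open>B_sqrt_A A\<close> only, so \<open>T\<close> and \<open>T\<^sup>\<sharp>\<close> must be shown to belong to it, and \<open>T\<^sup>\<sharp>\<close> must be shown to
  exist as a bounded operator.
  
  Existence rests on Hilbert space geometry: minimising a quadratic functional on a closed subspace
  yields adjoints and orthogonal projections (\<open>riesz_representation_closed_subspace\<close>), and projecting
  the solutions of the defining equation onto the closure of the range of \<open>A\<close> yields a linear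
  solution, bounded by Baire's theorem (\<open>A_adjoint_exists\<close>).
  
  Boundedness for the \<open>A\<close>-seminorm comes from the symmetry of \<open>T\<^sup>\<sharp> T\<close> with respect to the form
  \<open>inner (A x) y\<close>: along its powers the seminorms form a log-convex sequence, and a log-convex
  sequence that grows at most like \<open>K\<^sup>n\<close> has first ratio at most \<open>K\<close>
  (\<open>anorm_bounded_of_A_adjoint\<close>).\<close>

section \<open>Minimisation in Hilbert spaces\<close>

lemma parallelogram_identity:
  fixes x y :: "'a::real_inner"
  shows "(norm (x - y))\<^sup>2 = 2 * (norm x)\<^sup>2 + 2 * (norm y)\<^sup>2 - 4 * (norm ((1 / 2) *\<^sub>R (x + y)))\<^sup>2"
  by (simp add: power2_norm_eq_inner inner_left_distrib inner_right_distrib inner_diff_left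
      inner_diff_right inner_commute algebra_simps)

text \<open>Complete the square: a representing vector is a minimiser of \<open>J x = (norm x)\<^sup>2 - 2 * f x\<close> on \<open>M\<close>.
  The parallelogram identity makes every minimising sequence Cauchy, and the vanishing of the first
  variation of \<open>J\<close> at the limit is the representation formula. The subspace is a parameter so that
  one minimisation gives two classical results: the Riesz representation theorem for \<open>M = UNIV\<close>,
  and the orthogonal projection of \<open>y\<close> for \<open>f = inner y\<close>.\<close>

lemma riesz_representation_closed_subspace:
  fixes f :: "'a::{real_inner,complete_space} \<Rightarrow> real"
  assumes f: "bounded_linear f" and M: "subspace M" "closed M"
  obtains p where "p \<in> M" "\<And>m. m \<in> M \<Longrightarrow> inner p m = f m"
proof -
  interpret f: bounded_linear f by fact
  define J where "J x = (norm x)\<^sup>2 - 2 * f x" for x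
  obtain K where K: "\<And>x. norm (f x) \<le> norm x * K"
    using f.bounded by blast
  have lower: "- K\<^sup>2 \<le> J x" for x
  proof -
    have "2 * f x \<le> 2 * (norm x * K)"
      using K[of x] by simp
    moreover have "0 \<le> (norm x - K)\<^sup>2"
      by simp
    ultimately show ?thesis
      by (simp add: J_def power2_diff)
  qed
  define d where "d = Inf (J ` M)"
  have bdd: "bdd_below (J ` M)"
    using lower by (intro bdd_belowI2)
  have dJ: "d \<le> J x" if "x \<in> M" for x
    unfolding d_def using that bdd by (intro cInf_lower) auto
  have "\<exists>x\<in>M. J x < d + 1 / real (Suc n)" for n
  proof -
    have "J ` M \<noteq> {}"
      using subspace_0[OF M(1)] by blast
    from cInf_lessD[OF this, of "d + 1 / real (Suc n)"] show ?thesis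
      by (auto simp: d_def)
  qed
  then obtain X where XM: "\<And>n. X n \<in> M" and XJ: "\<And>n. J (X n) < d + 1 / real (Suc n)"
    by metis
  \<comment> \<open>The midpoint lies in \<open>M\<close>, so its value is at least \<open>d\<close>; the linear parts of \<open>J\<close> cancel.\<close>
  have gap: "(norm (x - y))\<^sup>2 \<le> 2 * (J x - d) + 2 * (J y - d)" if "x \<in> M" "y \<in> M" for x y
  proof -
    have "(1 / 2) *\<^sub>R (x + y) \<in> M"
      using M(1) that by (intro subspace_scale subspace_add)
    from dJ[OF this] have "d + f x + f y \<le> (norm ((1 / 2) *\<^sub>R (x + y)))\<^sup>2"
      unfolding J_def f.add f.scaleR by (simp add: add_divide_distrib)
    moreover define q where "q = (norm ((1 / 2) *\<^sub>R (x + y)))\<^sup>2"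
    ultimately have "d + f x + f y \<le> q"
      by (simp only:)
    moreover have "(norm (x - y))\<^sup>2 = 2 * (norm x)\<^sup>2 + 2 * (norm y)\<^sup>2 - 4 * q"
      unfolding q_def by (rule parallelogram_identity)
    ultimately show ?thesis
      unfolding J_def by (simp add: algebra_simps)
  qed
  have "Cauchy X"
  proof (rule metric_CauchyI)
    fix e :: real
    assume e: "0 < e"
    obtain n0 where n0: "4 / e\<^sup>2 < real n0"
      using reals_Archimedean2 by blast
    have "dist (X m) (X n) < e" if "m \<ge> n0" "n \<ge> n0" for m n
    proof -
      have *: "J (X k) - d < e\<^sup>2 / 4" if "k \<ge> n0" for k
      proof -
        have "4 / e\<^sup>2 < real (Suc k)"
          using n0 that by linarith
        then have "1 / real (Suc k) < e\<^sup>2 / 4"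
          using e by (simp add: field_simps)
        with XJ[of k] show ?thesis by linarith
      qed
      have "(norm (X m - X n))\<^sup>2 \<le> 2 * (J (X m) - d) + 2 * (J (X n) - d)"
        by (rule gap[OF XM XM])
      also have "\<dots> < 2 * (e\<^sup>2 / 4) + 2 * (e\<^sup>2 / 4)"
        using *[OF that(1)] *[OF that(2)] by (intro add_strict_mono mult_strict_left_mono) simp_all
      finally have "(norm (X m - X n))\<^sup>2 < e\<^sup>2"
        by simp
      then show ?thesis
        unfolding dist_norm by (rule power2_less_imp_less) (use e in simp)
    qed
    then show "\<exists>N. \<forall>m\<ge>N. \<forall>n\<ge>N. dist (X m) (X n) < e"
      by blast
  qed
  then obtain p where p: "X \<longlonglongrightarrow> p"
    using Cauchy_convergent convergent_def by blast
  have pM: "p \<in> M"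
    using closed_sequentially[OF M(2)] XM p by blast
  have "(\<lambda>n. J (X n)) \<longlonglongrightarrow> J p"
    unfolding J_def by (intro tendsto_intros p f.tendsto)
  moreover have "(\<lambda>n. d + 1 / real (Suc n)) \<longlonglongrightarrow> d + 0"
    by (intro tendsto_add tendsto_const LIMSEQ_Suc[OF lim_1_over_n])
  ultimately have Jp: "J p \<le> d"
    using XJ LIMSEQ_le[of "\<lambda>n. J (X n)" "J p" "\<lambda>n. d + 1 / real (Suc n)" d]
    by (auto intro: less_imp_le)
  have "inner p m = f m" if m: "m \<in> M" for m
  proof (cases "m = 0")
    case True
    then show ?thesis by (simp add: f.zero)
  next
    case False
    define b where "b = inner p m - f m"
    \<comment> \<open>This \<open>t\<close> minimises the quadratic polynomial \<open>J (p + t *\<^sub>R m)\<close>.\<close>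
    define t where "t = - b / (norm m)\<^sup>2"
    have n0: "(norm m)\<^sup>2 \<noteq> 0"
      using False by simp
    have "p + t *\<^sub>R m \<in> M"
      using M(1) pM m by (intro subspace_scale subspace_add)
    then have "J p \<le> J (p + t *\<^sub>R m)"
      using dJ Jp by force
    also have "\<dots> = J p + 2 * t * b + t\<^sup>2 * (norm m)\<^sup>2"
      unfolding J_def b_def f.add f.scaleR power2_norm_eq_inner
      by (simp add: inner_left_distrib inner_right_distrib inner_commute[of m p]
          power2_eq_square algebra_simps)
    also have "\<dots> = J p - b\<^sup>2 / (norm m)\<^sup>2"
      using n0 by (simp add: t_def power2_eq_square field_simps)
    finally have "b\<^sup>2 / (norm m)\<^sup>2 \<le> 0"
      by simp
    then have "b = 0"
      using n0 by (simp add: divide_le_0_iff)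
    then show ?thesis
      by (simp add: b_def)
  qed
  with pM that show ?thesis
    by blast
qed

lemma orthogonal_projection_exists:
  fixes y :: "'a::{real_inner,complete_space}"
  assumes "subspace M" "closed M"
  obtains p where "p \<in> M" "\<And>m. m \<in> M \<Longrightarrow> inner (y - p) m = 0"
proof -
  obtain p where "p \<in> M" "\<And>m. m \<in> M \<Longrightarrow> inner p m = inner y m"
    using riesz_representation_closed_subspace[OF bounded_linear_inner_right assms] by metis
  with that show ?thesis
    by (simp add: inner_diff_left)
qed

lemma real_adjoint_exists:
  fixes T :: "'a::{real_inner,complete_space} \<Rightarrow> 'a"
  assumes T: "bounded_linear T"
  obtains S where "bounded_linear S" "\<And>x y. inner (T x) y = inner x (S y)"
proof -
  interpret T: bounded_linear T by fact
  have "\<exists>v. \<forall>x. inner (T x) y = inner x v" for y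
  proof -
    have "bounded_linear (\<lambda>x. inner (T x) y)"
      by (intro bounded_linear_compose[OF bounded_linear_inner_left T])
    then obtain v where "\<And>x. inner v x = inner (T x) y"
      using riesz_representation_closed_subspace[of _ UNIV] by auto
    then show ?thesis
      by (metis inner_commute)
  qed
  then obtain S where S: "\<And>x y. inner (T x) y = inner x (S y)"
    by metis
  obtain K where K: "\<And>x. norm (T x) \<le> norm x * K"
    using T.bounded by blast
  have "bounded_linear S"
  proof (rule bounded_linear_intro)
    show "S (x + y) = S x + S y" for x y
      by (rule vector_eq_ldot[THEN iffD1], rule allI) (simp add: inner_right_distrib flip: S)
    show "S (r *\<^sub>R x) = r *\<^sub>R S x" for r x
      by (rule vector_eq_ldot[THEN iffD1], rule allI) (simp flip: S)
    fix x
    have "norm (S x) * norm (S x) = inner (T (S x)) x"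
      by (simp add: S norm_eq_sqrt_inner)
    also have "\<dots> \<le> norm (T (S x)) * norm x"
      by (rule norm_cauchy_schwarz)
    also have "\<dots> \<le> (norm (S x) * K) * norm x"
      by (intro mult_right_mono K) simp
    finally have *: "norm (S x) * norm (S x) \<le> norm (S x) * (norm x * K)"
      by (simp add: mult_ac)
    show "norm (S x) \<le> norm x * K"
    proof (cases "S x = 0")
      case True
      have "0 \<le> norm x * K"
        using K[of x] norm_ge_zero[of "T x"] by linarith
      with True show ?thesis by simp
    next
      case False
      with * show ?thesis by simp
    qed
  qed
  with S that show ?thesis
    by blast
qed

section \<open>Boundedness from Baire's theorem\<close>

text \<open>The sublevel sets cover the space, so by Baire's theorem one of them contains a ball, and by
  linearity \<open>X\<close> is then bounded near \<open>0\<close>. This is the principle of uniform boundedness in the form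
  needed for a map whose norm is a supremum of continuous functions: the sublevel sets of such a
  map are closed.\<close>

lemma linear_closed_sublevels_imp_bounded:
  fixes X :: "'a::{real_normed_vector,complete_space} \<Rightarrow> 'b::real_normed_vector"
  assumes X: "linear X" and cl: "\<And>n::nat. closed {x. norm (X x) \<le> real n}"
  shows "bounded_linear X"
proof -
  interpret X: linear X by fact
  let ?F = "\<lambda>n::nat. {x. norm (X x) \<le> real n}"
  have "\<exists>n. interior (?F n) \<noteq> {}"
  proof (rule ccontr)
    assume "\<not> ?thesis"
    moreover have "completely_metrizable_space (euclidean :: 'a topology)"
      by (rule completely_metrizable_space_euclidean)
    ultimately have "euclidean interior_of \<Union> (range ?F) = {}"
      using cl by (intro Baire_category_alt) auto
    then have "interior (\<Union> (range ?F)) = {}"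
      by simp
    moreover have "\<Union> (range ?F) = UNIV"
      using real_arch_simple by auto
    ultimately show False
      by simp
  qed
  then obtain n x0 where "x0 \<in> interior (?F n)"
    by blast
  then obtain r where r: "r > 0" "ball x0 r \<subseteq> ?F n"
    using mem_interior by blast
  have small: "norm (X h) \<le> 2 * real n" if "norm h < r" for h
  proof -
    have "norm (X (x0 + h)) \<le> real n" "norm (X x0) \<le> real n"
      using r that by (auto simp: subset_iff dist_norm)
    then show ?thesis
      using norm_triangle_ineq4[of "X (x0 + h)" "X x0"] by (simp add: X.add)
  qed
  have "norm (X x) \<le> norm x * (4 * real n / r)" for x
  proof (cases "x = 0")
    case True
    then show ?thesis by (simp add: X.zero)
  next
    case False
    have "norm (X ((r / (2 * norm x)) *\<^sub>R x)) \<le> 2 * real n"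
      using r False by (intro small) simp
    then show ?thesis
      using r False by (simp add: X.scaleR field_simps)
  qed
  then show ?thesis
    by (intro bounded_linear_intro X.add X.scaleR)
qed

section \<open>The seminorm of a positive operator\<close>

lemma subspace_closure:
  fixes S :: "'a::real_normed_vector set"
  assumes "subspace S"
  shows "subspace (closure S)"
  unfolding subspace_def
proof (intro conjI ballI allI)
  show "0 \<in> closure S"
    using subspace_0[OF assms] closure_subset by blast
next
  fix x y
  assume "x \<in> closure S" "y \<in> closure S"
  then obtain u v where "\<And>n. u n \<in> S" "u \<longlonglongrightarrow> x" "\<And>n. v n \<in> S" "v \<longlonglongrightarrow> y"
    by (auto simp: closure_sequential)
  then have "\<And>n. u n + v n \<in> S" "(\<lambda>n. u n + v n) \<longlonglongrightarrow> x + y"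
    by (auto intro: tendsto_add subspace_add[OF assms])
  then show "x + y \<in> closure S"
    unfolding closure_sequential by (intro exI[of _ "\<lambda>n. u n + v n"]) auto
next
  fix c :: real and x
  assume "x \<in> closure S"
  then obtain u where "\<And>n. u n \<in> S" "u \<longlonglongrightarrow> x"
    by (auto simp: closure_sequential)
  then have "\<And>n. c *\<^sub>R u n \<in> S" "(\<lambda>n. c *\<^sub>R u n) \<longlonglongrightarrow> c *\<^sub>R x"
    by (auto intro: tendsto_scaleR subspace_scale[OF assms])
  then show "c *\<^sub>R x \<in> closure S"
    unfolding closure_sequential by (intro exI[of _ "\<lambda>n. c *\<^sub>R u n"]) auto
qed

text \<open>The form \<open>inner (A x) y\<close> is real and symmetric; it is the real part of the semi-inner product that
  belongs to \<open>A\<close>, and \<open>cinner_eq_of_inner_eq\<close> below recovers the complex one from it.\<close>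

locale positive_operator =
  fixes A :: "'h::{real_inner,complete_space} \<Rightarrow> 'h"
  assumes bounded_linear_A: "bounded_linear A"
    and symmetric: "inner (A x) y = inner x (A y)"
    and nonneg: "0 \<le> inner (A x) x"
begin

sublocale A: bounded_linear A
  by (rule bounded_linear_A)

definition anorm :: "'h \<Rightarrow> real"
  where "anorm x = sqrt (inner (A x) x)"

lemma anorm_nonneg [simp]: "0 \<le> anorm x"
  by (simp add: anorm_def nonneg)

lemma anorm_square: "(anorm x)\<^sup>2 = inner (A x) x"
  by (simp add: anorm_def nonneg)

text \<open>The usual discriminant argument; since \<open>anorm\<close> may vanish on non-zero vectors, the case
  \<open>anorm y = 0\<close> is separate: there the quadratic degenerates to a linear function of \<open>t\<close>, which
  can only be bounded below if its slope is \<open>0\<close>.\<close>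

lemma anorm_cauchy_schwarz: "\<bar>inner (A x) y\<bar> \<le> anorm x * anorm y"
proof -
  define b where "b = inner (A x) y"
  have quad: "0 \<le> (anorm x)\<^sup>2 + 2 * t * b + t\<^sup>2 * (anorm y)\<^sup>2" for t
  proof -
    have "(anorm x)\<^sup>2 + 2 * t * b + t\<^sup>2 * (anorm y)\<^sup>2 = inner (A (x + t *\<^sub>R y)) (x + t *\<^sub>R y)"
      using symmetric[of y x] unfolding anorm_square b_def A.add A.scaleR
      by (simp add: inner_left_distrib inner_right_distrib inner_commute[of y "A x"]
          power2_eq_square algebra_simps)
    then show ?thesis
      by (simp add: nonneg)
  qed
  have "b\<^sup>2 \<le> (anorm x * anorm y)\<^sup>2"
  proof (cases "anorm y = 0")
    case True
    have "b = 0"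
    proof (rule ccontr)
      assume "b \<noteq> 0"
      then have "2 * (- ((anorm x)\<^sup>2 + 1) / (2 * b)) * b = - ((anorm x)\<^sup>2 + 1)"
        by simp
      then show False
        using quad[of "- ((anorm x)\<^sup>2 + 1) / (2 * b)"] True by (simp only:) simp
    qed
    then show ?thesis by simp
  next
    case False
    define q where "q = (anorm y)\<^sup>2"
    have pos: "0 < q"
      using False by (simp add: q_def)
    then have "2 * (- b / q) * b + (- b / q)\<^sup>2 * q = - (b\<^sup>2 / q)"
      by (simp add: power2_eq_square field_simps)
    then have "b\<^sup>2 / q \<le> (anorm x)\<^sup>2"
      using quad[of "- b / q"] by (simp add: q_def)
    with pos show ?thesis
      by (simp add: divide_le_eq power_mult_distrib q_def)
  qed
  then show ?thesis
    unfolding b_def[symmetric] using abs_le_square_iff[of b "anorm x * anorm y"] by simp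
qed

lemma anorm_triangle: "anorm (x + y) \<le> anorm x + anorm y"
proof (rule power2_le_imp_le)
  have "(anorm (x + y))\<^sup>2 = (anorm x)\<^sup>2 + 2 * inner (A x) y + (anorm y)\<^sup>2"
    using symmetric[of y x]
    by (simp add: anorm_square A.add inner_left_distrib inner_right_distrib
        inner_commute[of y "A x"])
  then show "(anorm (x + y))\<^sup>2 \<le> (anorm x + anorm y)\<^sup>2"
    using anorm_cauchy_schwarz[of x y] by (simp add: power2_sum)
qed simp

lemma anorm_le_norm: obtains C where "C \<ge> 0" "\<And>x. anorm x \<le> C * norm x"
proof -
  obtain K where K: "K > 0" "\<And>x. norm (A x) \<le> norm x * K"
    using A.pos_bounded by blast
  have K0: "inner (A x) x \<le> K * (norm x)\<^sup>2" for x
  proof -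
    have "inner (A x) x \<le> norm (A x) * norm x"
      by (rule norm_cauchy_schwarz)
    also have "\<dots> \<le> norm x * K * norm x"
      by (intro mult_right_mono K) simp
    finally show ?thesis
      by (simp add: power2_eq_square mult_ac)
  qed
  have "anorm x \<le> sqrt K * norm x" for x
    using real_sqrt_le_mono[OF K0[of x]] by (simp add: anorm_def real_sqrt_mult)
  with K that[of "sqrt K"] show ?thesis
    by simp
qed

text \<open>By symmetry the kernel of \<open>A\<close> is orthogonal to the range of \<open>A\<close>, hence to its closure. This is why
  the range condition singles out one solution \<open>X\<close> of the equation defining the \<open>A\<close>-adjoint.\<close>

lemma A_injective_on_closure_range:
  assumes "u \<in> closure (range A)" "v \<in> closure (range A)" "A u = A v"
  shows "u = v"
proof -
  have "subspace (closure (range A))"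
    by (intro subspace_closure linear_subspace_image A.linear subspace_UNIV)
  then have w: "u - v \<in> closure (range A)"
    using assms subspace_diff by blast
  have "closed {w. inner (u - v) w = 0}"
    by (intro closed_Collect_eq continuous_intros)
  moreover have "range A \<subseteq> {w. inner (u - v) w = 0}"
    using assms(3) by (auto simp: A.diff simp flip: symmetric)
  ultimately have "closure (range A) \<subseteq> {w. inner (u - v) w = 0}"
    by (rule closure_minimal[rotated])
  with w show ?thesis
    by auto
qed

section \<open>The adjoint with respect to the semi-inner product\<close>

text \<open>A special case of Douglas' range inclusion theorem. Any solution \<open>u\<close> can be projected onto
  the closure \<open>M\<close> of the range without changing \<open>A u\<close>, because the remainder is orthogonal to the
  range and so lies in the kernel. The solution in \<open>M\<close> is unique, hence depends linearly on \<open>x\<close>. For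
  boundedness, \<open>norm (X x)\<close> is determined by pairing \<open>X x\<close> with vectors \<open>A z\<close>, which are dense in
  \<open>M\<close>, and these pairings equal \<open>inner (A x) (T z)\<close>, continuous in \<open>x\<close>; so the sublevel sets are
  closed and \<open>linear_closed_sublevels_imp_bounded\<close> applies.\<close>

lemma A_adjoint_exists:
  assumes T: "bounded_linear T"
    and solvable: "\<And>x. \<exists>u. \<forall>y. inner (A u) y = inner (A x) (T y)"
  obtains X where "bounded_linear X" "range X \<subseteq> closure (range A)"
    "\<And>x y. inner (A (X x)) y = inner (A x) (T y)"
proof -
  interpret T: bounded_linear T by fact
  let ?M = "closure (range A)"
  have M: "subspace ?M"
    by (intro subspace_closure linear_subspace_image A.linear subspace_UNIV)
  have "\<exists>p\<in>?M. \<forall>y. inner (A p) y = inner (A x) (T y)" for x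
  proof -
    obtain u where u: "\<And>y. inner (A u) y = inner (A x) (T y)"
      using solvable by blast
    obtain p where p: "p \<in> ?M" "\<And>m. m \<in> ?M \<Longrightarrow> inner (u - p) m = 0"
      using orthogonal_projection_exists[OF M closed_closure, of u] by metis
    have "A (A (u - p)) \<in> ?M"
      using closure_subset[of "range A"] rangeI[of A "A (u - p)"] by (rule subsetD)
    from p(2)[OF this] have "inner (A (u - p)) (A (u - p)) = 0"
      by (simp add: symmetric)
    then have "A (u - p) = 0"
      by simp
    then have "A p = A u"
      by (simp add: A.diff)
    with u have "\<forall>y. inner (A p) y = inner (A x) (T y)"
      by simp
    with p(1) show ?thesis
      by (rule bexI[rotated])
  qed
  then obtain X where XM: "\<And>x. X x \<in> ?M" and X: "\<And>x y. inner (A (X x)) y = inner (A x) (T y)"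
    by metis
  have unique: "X x = v" if "v \<in> ?M" "\<And>y. inner (A v) y = inner (A x) (T y)" for x v
  proof -
    have "A (X x) = A v"
      by (rule vector_eq_rdot[THEN iffD1]) (simp add: X that)
    then show ?thesis
      by (rule A_injective_on_closure_range[OF XM that(1)])
  qed
  have "linear X"
  proof (rule linearI)
    show "X (x + y) = X x + X y" for x y
      by (rule unique) (simp_all add: subspace_add[OF M] XM A.add X inner_left_distrib)
    show "X (r *\<^sub>R x) = r *\<^sub>R X x" for r x
      by (rule unique) (simp_all add: subspace_scale[OF M] XM A.scaleR X)
  qed
  moreover have "closed {x. norm (X x) \<le> real n}" for n
  proof -
    have iff: "norm (X x) \<le> real n \<longleftrightarrow> (\<forall>z. inner (A x) (T z) \<le> real n * norm (A z))" for x
    proof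
      assume le: "norm (X x) \<le> real n"
      show "\<forall>z. inner (A x) (T z) \<le> real n * norm (A z)"
      proof
        fix z
        have "inner (A x) (T z) = inner (X x) (A z)"
          by (simp add: X flip: symmetric)
        also have "\<dots> \<le> norm (X x) * norm (A z)"
          by (rule norm_cauchy_schwarz)
        also have "\<dots> \<le> real n * norm (A z)"
          by (intro mult_right_mono le) simp
        finally show "inner (A x) (T z) \<le> real n * norm (A z)" .
      qed
    next
      assume *: "\<forall>z. inner (A x) (T z) \<le> real n * norm (A z)"
      have "closed {w. inner (X x) w \<le> real n * norm w}"
        by (intro closed_Collect_le continuous_intros)
      moreover have "range A \<subseteq> {w. inner (X x) w \<le> real n * norm w}"
        using * by (auto simp: X simp flip: symmetric)
      ultimately have "?M \<subseteq> {w. inner (X x) w \<le> real n * norm w}"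
        by (rule closure_minimal[rotated])
      then have "inner (X x) (X x) \<le> real n * norm (X x)"
        using XM by blast
      then have "norm (X x) * norm (X x) \<le> real n * norm (X x)"
        by (simp add: dot_square_norm power2_eq_square)
      then show "norm (X x) \<le> real n"
        by (cases "X x = 0") auto
    qed
    have "closed {x. inner (A x) (T z) \<le> real n * norm (A z)}" for z
      by (intro closed_Collect_le continuous_intros A.continuous_on)
    then show ?thesis
      unfolding iff by (intro closed_Collect_all)
  qed
  ultimately have "bounded_linear X"
    by (rule linear_closed_sublevels_imp_bounded)
  then show ?thesis
    using XM X by (intro that) auto
qed

text \<open>An operator with an \<open>A\<close>-adjoint is bounded for the \<open>A\<close>-seminorm, an argument of Krein and Lax.
  The operator \<open>P = X \<circ> T\<close> is symmetric for the form \<open>inner (A x) y\<close>, so by Cauchy-Schwarz the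
  sequence \<open>anorm (P\<^sup>n x)\<close> is log-convex: it grows at least geometrically with its first ratio. It
  also grows at most like \<open>K\<^sup>n\<close>, where \<open>K\<close> bounds \<open>P\<close> in the Hilbert space norm. Hence the first
  ratio is at most \<open>K\<close>, which bounds \<open>P\<close>, then \<open>T\<close> because \<open>(anorm (T x))\<^sup>2 = inner (A (P x)) x\<close>,
  and finally \<open>X\<close>.\<close>

lemma anorm_bounded_of_A_adjoint:
  assumes T: "bounded_linear T" and X: "bounded_linear X"
    and adj: "\<And>x y. inner (A (X x)) y = inner (A x) (T y)"
  obtains c where "c > 0" "\<And>x. anorm (T x) \<le> c * anorm x" "\<And>x. anorm (X x) \<le> c * anorm x"
proof -
  define P where "P = X \<circ> T"
  have adj': "inner (A x) (X y) = inner (A (T x)) y" for x y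
    using adj[of y x] symmetric by (metis inner_commute)
  have P: "inner (A (P x)) y = inner (A (T x)) (T y)" for x y
    by (simp add: P_def adj)
  have P_symmetric: "inner (A (P x)) y = inner (A x) (P y)" for x y
    by (simp add: P_def adj adj')
  have "bounded_linear P"
    unfolding P_def o_def by (rule bounded_linear_compose[OF X T])
  then obtain K where K: "K > 0" "\<And>x. norm (P x) \<le> norm x * K"
    using bounded_linear.pos_bounded by blast
  obtain C where C: "C \<ge> 0" "\<And>x. anorm x \<le> C * norm x"
    using anorm_le_norm by blast
  have P_le: "anorm (P x) \<le> K * anorm x" for x
  proof -
    define a where "a n = anorm ((P ^^ n) x)" for n
    have a0: "0 \<le> a n" for n
      by (simp add: a_def)
    have logconvex: "(a (Suc n))\<^sup>2 \<le> a n * a (Suc (Suc n))" for n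
    proof -
      have "(a (Suc n))\<^sup>2 = inner (A ((P ^^ n) x)) (P (P ((P ^^ n) x)))"
        by (simp add: a_def anorm_square P_symmetric)
      also have "\<dots> \<le> a n * a (Suc (Suc n))"
        using anorm_cauchy_schwarz[of "(P ^^ n) x" "P (P ((P ^^ n) x))"] by (simp add: a_def)
      finally show ?thesis .
    qed
    have upper: "a n \<le> C * norm x * K ^ n" for n
    proof -
      have "norm ((P ^^ n) x) \<le> norm x * K ^ n"
      proof (induction n)
        case (Suc n)
        then show ?case
          using K(2)[of "(P ^^ n) x"] mult_right_mono[OF Suc less_imp_le[OF K(1)]]
          by (simp add: mult_ac)
      qed simp
      then have "C * norm ((P ^^ n) x) \<le> C * (norm x * K ^ n)"
        using C(1) by (rule mult_left_mono)
      with C(2)[of "(P ^^ n) x"] show ?thesis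
        by (simp add: a_def)
    qed
    have "a 1 \<le> K * a 0"
    proof (rule ccontr)
      assume "\<not> ?thesis"
      then have gt: "K * a 0 < a 1"
        by simp
      have "a 0 \<noteq> 0"
        using logconvex[of 0] gt by auto
      then have pos: "0 < a 0"
        using a0[of 0] by simp
      define r where "r = a 1 / a 0"
      have r: "K < r" "0 < r"
      proof -
        show "K < r"
          using gt pos by (simp add: r_def less_divide_eq)
        with K(1) show "0 < r"
          by simp
      qed
      have step: "0 < a n \<and> r * a n \<le> a (Suc n)" for n
      proof (induction n)
        case 0
        show ?case
          using pos by (simp add: r_def)
      next
        case (Suc n)
        then have pos': "0 < a (Suc n)"
          using r by (meson mult_pos_pos order_less_le_trans)
        have "a n * (r * a (Suc n)) = r * a n * a (Suc n)"
          by simp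
        also have "\<dots> \<le> a (Suc n) * a (Suc n)"
          using Suc pos' by (intro mult_right_mono) auto
        also have "\<dots> \<le> a n * a (Suc (Suc n))"
          using logconvex[of n] by (simp add: power2_eq_square)
        finally have "r * a (Suc n) \<le> a (Suc (Suc n))"
          using Suc by simp
        with pos' show ?case by simp
      qed
      have lower: "a 0 * r ^ n \<le> a n" for n
      proof (induction n)
        case (Suc n)
        have "a 0 * r ^ Suc n \<le> r * a n"
          using mult_left_mono[OF Suc less_imp_le[OF r(2)]] by (simp add: mult_ac)
        with step[of n] show ?case
          by linarith
      qed simp
      have "(r / K) ^ n \<le> C * norm x / a 0" for n
        using order_trans[OF lower upper, of n] pos K(1)
        by (simp add: power_divide field_simps)
      moreover obtain n where "C * norm x / a 0 < (r / K) ^ n"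
        using real_arch_pow[of "r / K" "C * norm x / a 0"] r K(1) by auto
      ultimately show False
        by (meson not_le)
    qed
    then show ?thesis
      by (simp add: a_def)
  qed
  define c where "c = sqrt K"
  have c: "c > 0" "c * c = K"
    using K by (simp_all add: c_def)
  have Tc: "anorm (T x) \<le> c * anorm x" for x
  proof (rule power2_le_imp_le)
    have "(anorm (T x))\<^sup>2 = inner (A (P x)) x"
      by (simp add: anorm_square P)
    also have "\<dots> \<le> anorm (P x) * anorm x"
      using anorm_cauchy_schwarz[of "P x" x] by simp
    also have "\<dots> \<le> K * anorm x * anorm x"
      by (intro mult_right_mono P_le) simp
    also have "\<dots> = (c * anorm x)\<^sup>2"
      by (simp add: power2_eq_square flip: c(2))
    finally show "(anorm (T x))\<^sup>2 \<le> (c * anorm x)\<^sup>2" .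
  qed (use c in simp)
  have Xc: "anorm (X x) \<le> c * anorm x" for x
  proof -
    have "(anorm (X x))\<^sup>2 = inner (A x) (T (X x))"
      by (simp add: anorm_square adj)
    also have "\<dots> \<le> anorm x * anorm (T (X x))"
      using anorm_cauchy_schwarz[of x "T (X x)"] by simp
    also have "\<dots> \<le> anorm x * (c * anorm (X x))"
      by (intro mult_left_mono Tc) simp
    finally have *: "anorm (X x) * anorm (X x) \<le> (c * anorm x) * anorm (X x)"
      by (simp add: power2_eq_square mult_ac)
    show ?thesis
    proof (cases "anorm (X x) = 0")
      case False
      then have "0 < anorm (X x)"
        by (simp add: order_less_le)
      with * show ?thesis
        by (rule mult_right_le_imp_le)
    qed (use c in simp)
  qed
  from c(1) Tc Xc that show ?thesis
    by blast
qed

end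

section \<open>Complex inner products and adjoints\<close>

interpretation complex_vector: vector_space "scaleC :: complex \<Rightarrow> 'a \<Rightarrow> 'a::complex_vector"
  by standard (simp_all add: scaleC_add_right scaleC_add_left scaleC_scaleC scaleC_one)

lemma cinner_add_right: "cinner x (y + z) = cinner x y + cinner x z"
  by (metis cinner_add_left cinner_commute complex_cnj_add)

lemma cinner_scaleC_right: "cinner x (c *\<^sub>C y) = cnj c * cinner x y"
  by (metis cinner_commute cinner_scaleC_left complex_cnj_mult)

lemma Im_cinner: "Im (cinner x y) = inner x (\<i> *\<^sub>C y)"
  by (simp add: inner_Re_cinner cinner_scaleC_right)

lemma norm_scaleC: "norm (c *\<^sub>C (x :: 'a::complex_inner)) = cmod c * norm x"
proof -
  have "inner (c *\<^sub>C x) (c *\<^sub>C x) = Re ((c * cnj c) * cinner x x)"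
    by (simp add: inner_Re_cinner cinner_scaleC_left cinner_scaleC_right mult_ac)
  also have "\<dots> = (cmod c)\<^sup>2 * inner x x"
    by (simp only: complex_norm_square[symmetric]) (simp add: inner_Re_cinner)
  finally show ?thesis
    by (simp add: norm_eq_sqrt_inner real_sqrt_mult)
qed

lemma bounded_linear_scaleC: "bounded_linear (\<lambda>x :: 'a::complex_inner. c *\<^sub>C x)"
proof (rule bounded_linear_intro)
  show "c *\<^sub>C (x + y) = c *\<^sub>C x + c *\<^sub>C y" for x y :: 'a
    by (rule scaleC_add_right)
  show "c *\<^sub>C r *\<^sub>R x = r *\<^sub>R c *\<^sub>C x" for r and x :: 'a
    by (simp add: scaleR_scaleC scaleC_scaleC mult.commute)
  show "norm (c *\<^sub>C x) \<le> norm x * cmod c" for x :: 'a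
    by (simp add: norm_scaleC mult.commute)
qed

lemma bounded_clinear_add:
  "bounded_clinear T \<Longrightarrow> bounded_clinear S \<Longrightarrow> bounded_clinear (\<lambda>x. T x + S x)"
  unfolding bounded_clinear_def by (auto intro: bounded_linear_add simp: scaleC_add_right)

lemma bounded_clinear_scaleC: "bounded_clinear T \<Longrightarrow> bounded_clinear (\<lambda>x. c *\<^sub>C T x)"
  unfolding bounded_clinear_def
  by (auto intro: bounded_linear_compose[OF bounded_linear_scaleC] simp: scaleC_scaleC mult.commute)

lemma bounded_clinear_compose:
  "bounded_clinear T \<Longrightarrow> bounded_clinear S \<Longrightarrow> bounded_clinear (\<lambda>x. T (S x))"
  unfolding bounded_clinear_def by (auto intro: bounded_linear_compose)

text \<open>The imaginary part of a complex inner product is the real inner product with \<open>\<i> *\<^sub>C y\<close>, so a real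
  adjointness relation with a complex-linear operator is already a complex one.\<close>

lemma cinner_eq_of_inner_eq:
  assumes "bounded_clinear T" "\<And>y. inner u y = inner v (T y)"
  shows "cinner u y = cinner v (T y)"
  using assms(2)[of y] assms(2)[of "\<i> *\<^sub>C y"] assms(1)
  by (intro complex_eqI) (simp_all add: Im_cinner bounded_clinear_def flip: inner_Re_cinner)

lemma cinner_eq_imp_eq:
  assumes "\<And>y. cinner u y = cinner v y"
  shows "u = v"
  by (rule vector_eq_rdot[THEN iffD1]) (simp add: inner_Re_cinner assms)

text \<open>The real adjoint given by the Riesz representation serves as the complex one: complex linearity
  is inherited from the relation that defines it.\<close>

lemma cadjoint_unique_existence:
  assumes "bounded_clinear T"
  shows "\<exists>!S. bounded_clinear S \<and> (\<forall>x y. cinner (T x) y = cinner x (S y))"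
proof -
  obtain S where S: "bounded_linear S" "\<And>x y. inner (T x) y = inner x (S y)"
    using real_adjoint_exists assms unfolding bounded_clinear_def by metis
  have adj: "cinner (T x) y = cinner x (S y)" for x y
    using cinner_eq_of_inner_eq[OF assms, of "S y" y x] S(2) cinner_commute
    by (metis inner_commute)
  have "S (c *\<^sub>C y) = c *\<^sub>C S y" for c y
  proof (rule vector_eq_ldot[THEN iffD1], rule allI)
    show "inner x (S (c *\<^sub>C y)) = inner x (c *\<^sub>C S y)" for x
      by (simp add: inner_Re_cinner cinner_scaleC_right flip: adj)
  qed
  with S(1) have "bounded_clinear S"
    by (simp add: bounded_clinear_def)
  moreover have "S' = S" if "\<forall>x y. cinner (T x) y = cinner x (S' y)" for S'
  proof
    show "S' y = S y" for y
      by (rule vector_eq_ldot[THEN iffD1]) (simp add: inner_Re_cinner that[rule_format, symmetric] adj)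
  qed
  ultimately show ?thesis
    using adj by blast
qed

lemma cinner_cadjoint:
  assumes "bounded_clinear T"
  shows "cinner (T x) y = cinner x (cadjoint T y)"
  using theI'[OF cadjoint_unique_existence[OF assms]] unfolding cadjoint_def by blast

text \<open>Positivity forces symmetry by polarisation: a form that is real on the diagonal has
  \<open>Im (cinner (A x) y) + Im (cinner (A y) x) = 0\<close>, and replacing \<open>x\<close> by \<open>\<i> *\<^sub>C x\<close> gives the same
  statement for a difference of real parts.\<close>

lemma positive_op_imp_positive_operator:
  assumes "positive_op A"
  shows "positive_operator A"
proof (rule positive_operator.intro)
  have A: "bounded_clinear A" and Im0: "\<And>x. Im (cinner (A x) x) = 0"
    and Re0: "\<And>x. 0 \<le> Re (cinner (A x) x)"
    using assms by (auto simp: positive_op_def complex_nonneg_Reals_iff)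
  from A interpret A: bounded_linear A
    by (simp add: bounded_clinear_def)
  show "bounded_linear A"
    by (rule A.bounded_linear_axioms)
  show "0 \<le> inner (A x) x" for x
    by (simp add: inner_Re_cinner Re0)
  have Im_sum: "Im (cinner (A x) y) + Im (cinner (A y) x) = 0" for x y
    using Im0[of "x + y"] Im0[of x] Im0[of y]
    by (simp add: A.add cinner_add_left cinner_add_right)
  show "inner (A x) y = inner x (A y)" for x y
    using Im_sum[of "\<i> *\<^sub>C x" y] A
    by (simp add: inner_Re_cinner bounded_clinear_def cinner_scaleC_left cinner_scaleC_right
        cinner_commute[of x "A y"])
qed

lemma norm_A_eq_anorm: "positive_op A \<Longrightarrow> norm_A A = positive_operator.anorm A"
  by (simp add: fun_eq_iff norm_A_def positive_operator.anorm_def inner_Re_cinner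
      positive_op_imp_positive_operator)

section \<open>The operator \<open>T\<^sup>\<sharp>\<close>\<close>

text \<open>Testing against all vectors removes the adjoint of \<open>T\<close> from the equation for the \<open>A\<close>-adjoint; in
  this form it is a statement about \<open>A\<close> and \<open>T\<close> alone.\<close>

lemma sharp_A_iff:
  assumes "bounded_clinear T"
  shows "A \<circ> X = cadjoint T \<circ> A \<longleftrightarrow> (\<forall>x y. cinner (A (X x)) y = cinner (A x) (T y))"
proof -
  have eq: "cinner (cadjoint T (A x)) y = cinner (A x) (T y)" for x y
    by (metis assms cinner_cadjoint cinner_commute)
  have "A (X x) = cadjoint T (A x) \<longleftrightarrow> (\<forall>y. cinner (A (X x)) y = cinner (A x) (T y))" for x
    using cinner_eq_imp_eq[of "A (X x)" "cadjoint T (A x)"] by (metis eq)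
  then show ?thesis
    by (simp add: fun_eq_iff)
qed

lemma sharp_A_eqI:
  assumes A: "positive_op A" and T: "bounded_clinear T" and X: "bounded_clinear X"
    and adj: "\<And>x y. cinner (A (X x)) y = cinner (A x) (T y)"
    and ran: "range X \<subseteq> closure (range A)"
  shows "sharp_A A T = X"
  unfolding sharp_A_def
proof (rule the_equality)
  show X': "bounded_clinear X \<and> A \<circ> X = cadjoint T \<circ> A \<and> range X \<subseteq> closure (range A)"
    using sharp_A_iff[OF T] X adj ran by blast
  fix Y
  assume Y: "bounded_clinear Y \<and> A \<circ> Y = cadjoint T \<circ> A \<and> range Y \<subseteq> closure (range A)"
  interpret positive_operator A
    using A by (rule positive_op_imp_positive_operator)
  show "Y = X"
  proof
    fix x
    have "(A \<circ> Y) x = (A \<circ> X) x"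
      using X' Y by simp
    moreover have "Y x \<in> closure (range A)" "X x \<in> closure (range A)"
      using Y ran by auto
    ultimately show "Y x = X x"
      using A_injective_on_closure_range by simp
  qed
qed

lemma scaleC_closure_range:
  assumes "bounded_clinear A" "u \<in> closure (range A)"
  shows "c *\<^sub>C u \<in> closure (range A)"
proof -
  have "(\<lambda>x. c *\<^sub>C x) ` closure (range A) \<subseteq> closure ((\<lambda>x. c *\<^sub>C x) ` range A)"
    by (intro image_closure_subset linear_continuous_on bounded_linear_scaleC closed_closure closure_subset)
  also have "\<dots> \<subseteq> closure (range A)"
  proof (intro closure_mono image_subsetI)
    fix v
    assume "v \<in> range A"
    then obtain x where "v = A x"
      by blast
    then have "c *\<^sub>C v = A (c *\<^sub>C x)"
      using assms(1) by (simp add: bounded_clinear_def)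
    then show "c *\<^sub>C v \<in> range A"
      by simp
  qed
  finally show ?thesis
    using assms(2) by blast
qed

text \<open>The description by \<open>THE\<close> is meaningful on \<open>B_A A\<close>: the range inclusion gives the solvability
  hypothesis of \<open>A_adjoint_exists\<close>, and complex linearity of the solution follows from uniqueness.\<close>

lemma sharp_A:
  assumes A: "positive_op A" and T: "T \<in> B_A A"
  shows bounded_clinear_sharp_A: "bounded_clinear (sharp_A A T)"
    and cinner_sharp_A: "cinner (A (sharp_A A T x)) y = cinner (A x) (T y)"
    and range_sharp_A: "range (sharp_A A T) \<subseteq> closure (range A)"
proof -
  interpret positive_operator A
    using A by (rule positive_op_imp_positive_operator)
  have clin: "bounded_clinear A" "bounded_clinear T"
    using A T by (simp_all add: positive_op_def B_A_def)
  then have bT: "bounded_linear T"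
    by (simp add: bounded_clinear_def)
  have "\<exists>u. \<forall>y. inner (A u) y = inner (A x) (T y)" for x
  proof -
    have "(cadjoint T \<circ> A) x \<in> range A"
      using T by (auto simp: B_A_def)
    then obtain u where "A u = cadjoint T (A x)"
      by auto
    then have "inner (A u) y = inner (A x) (T y)" for y
      using cinner_cadjoint[OF clin(2), of y "A x"] by (metis inner_Re_cinner inner_commute)
    then show ?thesis by blast
  qed
  from A_adjoint_exists[OF bT this] obtain X where X: "bounded_linear X"
    "range X \<subseteq> closure (range A)" "\<And>x y. inner (A (X x)) y = inner (A x) (T y)"
    by blast
  have adj: "cinner (A (X x)) y = cinner (A x) (T y)" for x y
    using X(3) by (rule cinner_eq_of_inner_eq[OF clin(2)])
  have Ac: "A (c *\<^sub>C x) = c *\<^sub>C A x" for c x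
    using clin(1) by (simp add: bounded_clinear_def)
  have "X (c *\<^sub>C x) = c *\<^sub>C X x" for c x
  proof (rule A_injective_on_closure_range)
    show "A (X (c *\<^sub>C x)) = A (c *\<^sub>C X x)"
      by (rule cinner_eq_imp_eq) (simp add: adj Ac cinner_scaleC_left)
    show "X (c *\<^sub>C x) \<in> closure (range A)" "c *\<^sub>C X x \<in> closure (range A)"
      using X(2) scaleC_closure_range[OF clin(1)] by auto
  qed
  with X(1) have bX: "bounded_clinear X"
    by (simp add: bounded_clinear_def)
  have "sharp_A A T = X"
    by (rule sharp_A_eqI[OF A clin(2) bX adj X(2)])
  with bX adj X(2) show "bounded_clinear (sharp_A A T)"
    "cinner (A (sharp_A A T x)) y = cinner (A x) (T y)"
    "range (sharp_A A T) \<subseteq> closure (range A)"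
    by simp_all
qed

lemma sharp_A_scaleC:
  assumes A: "positive_op A" and T: "T \<in> B_A A"
  shows "sharp_A A (\<lambda>x. c *\<^sub>C T x) = (\<lambda>x. cnj c *\<^sub>C sharp_A A T x)"
proof (rule sharp_A_eqI[OF A])
  have clin: "bounded_clinear A" "bounded_clinear T"
    using A T by (simp_all add: positive_op_def B_A_def)
  then have Ac: "A (c *\<^sub>C x) = c *\<^sub>C A x" for c x
    by (simp add: bounded_clinear_def)
  show "bounded_clinear (\<lambda>x. c *\<^sub>C T x)"
    using clin(2) by (rule bounded_clinear_scaleC)
  show "bounded_clinear (\<lambda>x. cnj c *\<^sub>C sharp_A A T x)"
    using bounded_clinear_sharp_A[OF A T] by (rule bounded_clinear_scaleC)
  show "cinner (A (cnj c *\<^sub>C sharp_A A T x)) y = cinner (A x) (c *\<^sub>C T y)" for x y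
    by (simp add: Ac cinner_scaleC_left cinner_scaleC_right cinner_sharp_A[OF A T])
  show "range (\<lambda>x. cnj c *\<^sub>C sharp_A A T x) \<subseteq> closure (range A)"
    using range_sharp_A[OF A T] scaleC_closure_range[OF clin(1)] by auto
qed

section \<open>The algebra of operators bounded for the \<open>A\<close>-seminorm\<close>

lemma B_A_imp_B_sqrt_A:
  assumes A: "positive_op A" and T: "T \<in> B_A A"
  shows "T \<in> B_sqrt_A A" and "sharp_A A T \<in> B_sqrt_A A"
proof -
  interpret positive_operator A
    using A by (rule positive_op_imp_positive_operator)
  have clin: "bounded_clinear T" "bounded_clinear (sharp_A A T)"
    using T bounded_clinear_sharp_A[OF A T] by (simp_all add: B_A_def)
  then have lin: "bounded_linear T" "bounded_linear (sharp_A A T)"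
    by (simp_all add: bounded_clinear_def)
  have "inner (A (sharp_A A T x)) y = inner (A x) (T y)" for x y
    by (simp add: inner_Re_cinner cinner_sharp_A[OF A T])
  from anorm_bounded_of_A_adjoint[OF lin this] obtain c where "c > 0"
    "\<And>x. anorm (T x) \<le> c * anorm x" "\<And>x. anorm (sharp_A A T x) \<le> c * anorm x"
    by blast
  with clin show "T \<in> B_sqrt_A A" "sharp_A A T \<in> B_sqrt_A A"
    by (auto simp: B_sqrt_A_def norm_A_eq_anorm[OF A])
qed

lemma B_sqrt_A_add:
  assumes A: "positive_op A" and "T \<in> B_sqrt_A A" "S \<in> B_sqrt_A A"
  shows "(\<lambda>x. T x + S x) \<in> B_sqrt_A A"
proof -
  interpret positive_operator A
    using A by (rule positive_op_imp_positive_operator)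
  obtain c d where c: "c > 0" "\<And>x. anorm (T x) \<le> c * anorm x"
    and d: "d > 0" "\<And>x. anorm (S x) \<le> d * anorm x"
    using assms(2,3) by (auto simp: B_sqrt_A_def norm_A_eq_anorm[OF A])
  have "anorm (T x + S x) \<le> (c + d) * anorm x" for x
    using anorm_triangle[of "T x" "S x"] c(2)[of x] d(2)[of x] by (simp add: distrib_right)
  moreover have "c + d > 0"
    using c(1) d(1) by simp
  ultimately show ?thesis
    using assms(2,3) by (auto simp: B_sqrt_A_def norm_A_eq_anorm[OF A] intro: bounded_clinear_add)
qed

lemma norm_A_scaleC:
  assumes "positive_op A"
  shows "norm_A A (c *\<^sub>C x) = cmod c * norm_A A x"
proof -
  have "cinner (A (c *\<^sub>C x)) (c *\<^sub>C x) = (c * cnj c) * cinner (A x) x"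
    using assms
    by (simp add: positive_op_def bounded_clinear_def cinner_scaleC_left cinner_scaleC_right mult_ac)
  then have "Re (cinner (A (c *\<^sub>C x)) (c *\<^sub>C x)) = (cmod c)\<^sup>2 * Re (cinner (A x) x)"
    by (simp only: complex_norm_square[symmetric]) simp
  then show ?thesis
    by (simp add: norm_A_def real_sqrt_mult)
qed

lemma B_sqrt_A_scaleC:
  assumes A: "positive_op A" and T: "T \<in> B_sqrt_A A"
  shows "(\<lambda>x. c *\<^sub>C T x) \<in> B_sqrt_A A"
proof -
  obtain d where d: "d > 0" "\<And>x. norm_A A (T x) \<le> d * norm_A A x"
    using T by (auto simp: B_sqrt_A_def)
  have "norm_A A (c *\<^sub>C T x) \<le> ((cmod c + 1) * d) * norm_A A x" for x
  proof -
    have nn: "0 \<le> norm_A A y" for y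
      using A by (simp add: norm_A_eq_anorm positive_op_imp_positive_operator
          positive_operator.anorm_nonneg)
    \<comment> \<open>The summand 1 keeps the constant positive when \<open>c = 0\<close>.\<close>
    have "norm_A A (c *\<^sub>C T x) \<le> (cmod c + 1) * norm_A A (T x)"
      using nn[of "T x"] by (simp add: norm_A_scaleC[OF A] distrib_right)
    also have "\<dots> \<le> (cmod c + 1) * (d * norm_A A x)"
      by (intro mult_left_mono d(2)) simp
    finally show ?thesis
      by (simp add: mult_ac)
  qed
  moreover have "(cmod c + 1) * d > 0"
    using d(1) by (simp add: add_nonneg_pos)
  ultimately show ?thesis
    using T by (auto simp: B_sqrt_A_def intro: bounded_clinear_scaleC)
qed

lemma B_sqrt_A_compose:
  assumes "T \<in> B_sqrt_A A" "S \<in> B_sqrt_A A"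
  shows "T \<circ> S \<in> B_sqrt_A A"
proof -
  obtain c d where c: "c > 0" "\<And>x. norm_A A (T x) \<le> c * norm_A A x"
    and d: "d > 0" "\<And>x. norm_A A (S x) \<le> d * norm_A A x"
    using assms by (auto simp: B_sqrt_A_def)
  have "norm_A A (T (S x)) \<le> (c * d) * norm_A A x" for x
  proof -
    have "norm_A A (T (S x)) \<le> c * (d * norm_A A x)"
      using c(2)[of "S x"] mult_left_mono[OF d(2)[of x], of c] c(1) by linarith
    then show ?thesis
      by (simp add: mult_ac)
  qed
  moreover have "c * d > 0"
    using c(1) d(1) by simp
  ultimately show ?thesis
    using assms by (auto simp: B_sqrt_A_def o_def intro: bounded_clinear_compose)
qed

lemma Re_A_Im_A_in_B_sqrt_A:
  assumes A: "positive_op A" and T: "T \<in> B_A A"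
  shows "Re_A A T \<in> B_sqrt_A A" and "Im_A A T \<in> B_sqrt_A A"
proof -
  note mem = B_A_imp_B_sqrt_A[OF A T]
  show "Re_A A T \<in> B_sqrt_A A"
    unfolding Re_A_def using mem by (intro B_sqrt_A_scaleC B_sqrt_A_add A)
  have "Im_A A T = (\<lambda>x. (1 / (2 * \<i>)) *\<^sub>C (T x + (-1) *\<^sub>C sharp_A A T x))"
    by (simp add: Im_A_def)
  then show "Im_A A T \<in> B_sqrt_A A"
    using mem by (simp only:) (intro B_sqrt_A_scaleC B_sqrt_A_add A)
qed

section \<open>The numerical radius bound\<close>

lemma Re_A_cis:
  assumes "positive_op A" "T \<in> B_A A"
  shows "Re_A A (\<lambda>x. cis \<theta> *\<^sub>C T x)
    = (\<lambda>x. (1 / 2) *\<^sub>C (cis \<theta> *\<^sub>C T x + cis (- \<theta>) *\<^sub>C sharp_A A T x))"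
  by (simp add: Re_A_def sharp_A_scaleC[OF assms] cis_cnj)

text \<open>Both \<open>Re_A A T\<close> and \<open>Im_A A T\<close> are thus among the operators over which \<open>omega\<close> takes the
  supremum, at the angles \<open>0\<close> and \<open>- (pi / 2)\<close>.\<close>

lemma Re_A_rotate_eq_Im_A:
  assumes "positive_op A" "T \<in> B_A A"
  shows "Re_A A (\<lambda>x. cis (- (pi / 2)) *\<^sub>C T x) = Im_A A T"
  unfolding Re_A_cis[OF assms] Im_A_def
  by (simp add: fun_eq_iff scaleC_scaleC complex_vector.scale_right_diff_distrib
      complex_vector.scale_right_distrib cis_minus_pi_half)

lemma seminorm_B_scaleC:
  "seminorm_B A N \<Longrightarrow> T \<in> B_sqrt_A A \<Longrightarrow> N (\<lambda>x. c *\<^sub>C T x) = cmod c * N T"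
  by (simp add: seminorm_B_def)

lemma seminorm_B_add:
  "seminorm_B A N \<Longrightarrow> T \<in> B_sqrt_A A \<Longrightarrow> S \<in> B_sqrt_A A
    \<Longrightarrow> N (\<lambda>x. T x + S x) \<le> N T + N S"
  by (simp add: seminorm_B_def)

text \<open>A supremum of reals is an upper bound only of a set that is bounded above; here
  \<open>(N T + N (sharp_A A T)) / 2\<close> is a bound, finite because both operators lie in \<open>B_sqrt_A A\<close>.\<close>

lemma seminorm_rotated_Re_A_le_omega:
  assumes A: "positive_op A" and N: "seminorm_B A N" and T: "T \<in> B_A A"
  shows "N (Re_A A (\<lambda>x. cis \<theta> *\<^sub>C T x)) \<le> omega N A T"
proof -
  note mem = B_A_imp_B_sqrt_A[OF A T]
  let ?X = "sharp_A A T"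
  note tri = seminorm_B_add[OF N] and hom = seminorm_B_scaleC[OF N]
  have "N (Re_A A (\<lambda>x. cis \<theta> *\<^sub>C T x)) \<le> (N T + N ?X) / 2" for \<theta>
  proof -
    have 1: "(\<lambda>x. cis \<theta> *\<^sub>C T x) \<in> B_sqrt_A A" and 2: "(\<lambda>x. cis (- \<theta>) *\<^sub>C ?X x) \<in> B_sqrt_A A"
      by (intro B_sqrt_A_scaleC A mem)+
    have "N (Re_A A (\<lambda>x. cis \<theta> *\<^sub>C T x)) = 1 / 2 * N (\<lambda>x. cis \<theta> *\<^sub>C T x + cis (- \<theta>) *\<^sub>C ?X x)"
      unfolding Re_A_cis[OF A T] by (subst hom) (use B_sqrt_A_add[OF A 1 2] in auto)
    also have "\<dots> \<le> 1 / 2 * (N T + N ?X)"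
      using tri[OF 1 2] hom[OF mem(1)] hom[OF mem(2)] by simp
    finally show ?thesis by simp
  qed
  then have "bdd_above (range (\<lambda>\<theta>. N (Re_A A (\<lambda>x. cis \<theta> *\<^sub>C T x))))"
    by (intro bdd_aboveI2)
  then show ?thesis
    unfolding omega_def by (intro cSUP_upper) auto
qed

text \<open>With \<open>R = Re_A A T\<close> and \<open>I = Im_A A T\<close> one has \<open>T = R + \<i> I\<close> and \<open>sharp_A A T = R - \<i> I\<close>, so in
  \<open>sharp_A A T T + T (sharp_A A T)\<close> the mixed terms cancel and twice the sum of squares remains.\<close>

lemma sharp_A_square_sum:
  assumes A: "positive_op A" and T: "T \<in> B_A A"
  shows "sharp_A A T (T x) + T (sharp_A A T x)
    = 2 *\<^sub>C (Re_A A T (Re_A A T x) + Im_A A T (Im_A A T x))"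
proof -
  let ?X = "sharp_A A T"
  have "bounded_clinear T" "bounded_clinear ?X"
    using T bounded_clinear_sharp_A[OF A T] by (simp_all add: B_A_def)
  then have lin: "bounded_linear T" "bounded_linear ?X"
    and scale: "T (c *\<^sub>C y) = c *\<^sub>C T y" "?X (c *\<^sub>C y) = c *\<^sub>C ?X y" for c y
    by (simp_all add: bounded_clinear_def)
  interpret T: bounded_linear T
    by (rule lin)
  interpret X: bounded_linear ?X
    by (rule lin)
  let ?u = "T (T x) + T (?X x) + (?X (T x) + ?X (?X x))"
  let ?v = "T (T x) - T (?X x) - (?X (T x) - ?X (?X x))"
  let ?w = "?X (T x) + T (?X x)"
  have R: "Re_A A T (Re_A A T x) = (1 / 2 * (1 / 2)) *\<^sub>C ?u"
    by (simp only: Re_A_def scale T.add X.add scaleC_add_right scaleC_scaleC)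
  have I: "Im_A A T (Im_A A T x) = (1 / (2 * \<i>) * (1 / (2 * \<i>))) *\<^sub>C ?v"
    by (simp only: Im_A_def scale T.diff X.diff complex_vector.scale_right_diff_distrib scaleC_scaleC)
  have quarter: "1 / 2 * (1 / 2) = (1 / 4 :: complex)"
    by simp
  have i: "1 / (2 * \<i>) * (1 / (2 * \<i>)) = - (1 / 4)"
    by (simp add: complex_eq_iff)
  have "Re_A A T (Re_A A T x) + Im_A A T (Im_A A T x) = (1 / 4) *\<^sub>C (?u - ?v)"
    unfolding R I i quarter complex_vector.scale_right_diff_distrib[of _ ?u ?v]
      complex_vector.scale_minus_left by (rule add_uminus_conv_diff)
  also have "?u - ?v = 2 *\<^sub>C ?w"
    using scaleC_add_left[of 1 1 ?w] by (simp add: scaleC_one)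
  finally show ?thesis
    by (simp add: scaleC_scaleC scaleC_one)
qed

theorem theorem2p8:
  fixes A T :: "'h::complex_hilbert \<Rightarrow> 'h"
    and N :: "('h \<Rightarrow> 'h) \<Rightarrow> real"
  assumes "positive_op A"
    and "A \<noteq> (\<lambda>x. 0)"
    and "seminorm_B A N"
    and "submultiplicative_B A N"
    and "T \<in> B_A A"
  shows "omega N A T \<ge>
    sqrt (1 / 4 * N (\<lambda>x. sharp_A A T (T x) + T (sharp_A A T x))
          + 1 / 2 * \<bar>(N (Re_A A T))\<^sup>2 - (N (Im_A A T))\<^sup>2\<bar>)"
proof -
  let ?R = "Re_A A T" and ?I = "Im_A A T"
  \<comment> \<open>For \<open>a = 2 * (r + i)\<close> the left side is the maximum of \<open>r\<close> and \<open>i\<close>.\<close>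
  have max_bound: "1 / 4 * a + 1 / 2 * \<bar>r - i\<bar> \<le> w"
    if "a \<le> 2 * (r + i)" "r \<le> w" "i \<le> w" for a r i w :: real
    using that by argo
  have mem: "?R \<in> B_sqrt_A A" "?I \<in> B_sqrt_A A"
    using assms by (simp_all add: Re_A_Im_A_in_B_sqrt_A)
  have mem2: "?R \<circ> ?R \<in> B_sqrt_A A" "?I \<circ> ?I \<in> B_sqrt_A A"
    by (intro B_sqrt_A_compose mem)+
  have N0: "0 \<le> N ?R" "0 \<le> N ?I"
    using assms(3) mem by (simp_all add: seminorm_B_def)
  have "N ?R \<le> omega N A T"
    using seminorm_rotated_Re_A_le_omega[OF assms(1,3,5), of 0] by (simp add: scaleC_one)
  moreover have "N ?I \<le> omega N A T"
    using seminorm_rotated_Re_A_le_omega[OF assms(1,3,5), of "- (pi / 2)"] Re_A_rotate_eq_Im_A[OF assms(1,5)] by simp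
  ultimately have le: "(N ?R)\<^sup>2 \<le> (omega N A T)\<^sup>2" "(N ?I)\<^sup>2 \<le> (omega N A T)\<^sup>2"
    and om: "0 \<le> omega N A T"
    using N0 by (auto intro: power_mono)
  have "N (\<lambda>x. sharp_A A T (T x) + T (sharp_A A T x))
      = N (\<lambda>x. 2 *\<^sub>C ((?R \<circ> ?R) x + (?I \<circ> ?I) x))"
    by (simp add: sharp_A_square_sum[OF assms(1,5)])
  also have "\<dots> = cmod 2 * N (\<lambda>x. (?R \<circ> ?R) x + (?I \<circ> ?I) x)"
    by (intro seminorm_B_scaleC[OF assms(3)] B_sqrt_A_add assms(1) mem2)
  also have "\<dots> \<le> cmod 2 * (N (?R \<circ> ?R) + N (?I \<circ> ?I))"
    by (intro mult_left_mono norm_ge_zero seminorm_B_add[OF assms(3)] mem2)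
  also have "\<dots> \<le> cmod 2 * (N ?R * N ?R + N ?I * N ?I)"
    using assms(4) mem unfolding submultiplicative_B_def
    by (intro mult_left_mono norm_ge_zero add_mono) blast+
  also have "\<dots> = 2 * ((N ?R)\<^sup>2 + (N ?I)\<^sup>2)"
    by (simp add: power2_eq_square)
  finally have "1 / 4 * N (\<lambda>x. sharp_A A T (T x) + T (sharp_A A T x))
      + 1 / 2 * \<bar>(N ?R)\<^sup>2 - (N ?I)\<^sup>2\<bar> \<le> (omega N A T)\<^sup>2"
    using le by (rule max_bound)
  then show ?thesis
    using real_sqrt_le_mono om by fastforce
qed

end
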